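(* (Strong $\chi^2$ inequality.) Let $A$ be a nonzero real symmetric $n\times n$ matrix with rank $r(A)$, let $\lambda^*_{\max}(A)$ be the largest nonzero eigenvalue of $A$, let $\underline{\boldsymbol{x}}\sim N(\underline 0,I_n)$ and $\boldsymbol{\Delta}=\underline{\boldsymbol{x}}^{\mathsf T}A\underline{\boldsymbol{x}}-\mathrm{tr}(A)$. Then for every $t>0$, $$\Pr(\boldsymbol{\Delta}>t)\le\begin{cases}1-F_{\chi^2_{r(A)}}\Big(\dfrac{t+\mathrm{tr}(A)}{\lambda^*_{\max}(A)}\Big), & \lambda^*_{\max}(A)>0,\\[2mm] F_{\chi^2_{r(A)}}\Big(\dfrac{t+\mathrm{tr}(A)}{\lambda^*_{\max}(A)}\Big), & \lambda^*_{\max}(A)<0.\end{cases}$$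
   Context: $F_{\chi^2_k}$ denotes the CDF of a $\chi^2$ random variable with $k$ degrees of freedom (equal to $0$ on $(-\infty,0]$). "Largest nonzero eigenvalue" means the maximum of the set of nonzero eigenvalues (in the usual order of the reals). *)

theory Defs
  imports "HOL-Probability.Probability"
begin

text \<open>Density of \<open>N(\<mu>, \<Sigma>)\<close> with respect to Lebesgue measure, for positive definite \<open>\<Sigma>\<close>.\<close>

definition mvnormal_density :: "real^'n \<Rightarrow> real^'n^'n \<Rightarrow> real^'n \<Rightarrow> real" where
  "mvnormal_density \<mu> \<Sigma> x =
     exp (- ((x - \<mu>) \<bullet> (matrix_inv \<Sigma> *v (x - \<mu>))) / 2) / sqrt ((2 * pi) ^ CARD('n) * det \<Sigma>)"

definition chi_square :: "nat \<Rightarrow> real measure" where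
  "chi_square k =
     distr (\<Pi>\<^sub>M i\<in>{..<k}. density lborel (\<lambda>x. ennreal (std_normal_density x))) borel
       (\<lambda>z. \<Sum>i<k. (z i)\<^sup>2)"

definition eigenvalue :: "real^'n^'n \<Rightarrow> real \<Rightarrow> bool" where
  "eigenvalue A l \<longleftrightarrow> (\<exists>v. v \<noteq> 0 \<and> A *v v = l *\<^sub>R v)"

text \<open>The \<open>Max\<close> below is only meaningful when there is at least one nonzero eigenvalue, which is
  the case for nonzero symmetric \<open>A\<close>.\<close>

definition largest_nonzero_eigenvalue :: "real^'n^'n \<Rightarrow> real" where
  "largest_nonzero_eigenvalue A = Max {l. eigenvalue A l \<and> l \<noteq> 0}"

end

theory Submission
  imports Defs
begin

text \<open>
  Let \<open>W\<close> be the range of \<open>A\<close>, a space of dimension \<open>rank A\<close>, and let \<open>B\<close> be an orthonormal basis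
  of it. As \<open>A\<close> is symmetric, its kernel is the orthogonal complement of \<open>W\<close>, so the quadratic form
  of \<open>A\<close> at \<open>x\<close> depends only on the projection of \<open>x\<close> to \<open>W\<close>. On \<open>W\<close> the maximal
  Rayleigh quotient is an eigenvalue of \<open>A\<close>, and it is nonzero because \<open>W\<close> meets the kernel only
  in \<open>0\<close>; it is therefore at most the largest nonzero eigenvalue \<open>\<lambda>\<close>. This gives the pointwise
  bound \<open>x \<bullet> A x \<le> \<lambda> S(x)\<close>, where \<open>S(x)\<close> is the sum of the \<open>(x \<bullet> b)\<^sup>2\<close> with \<open>b \<in> B\<close>
  (lemma \<open>quadratic_form_le_projection\<close>).

  The standard Gaussian density depends on the norm only, and Lebesgue measure is invariant under
  orthogonal maps; hence the coordinates of a standard Gaussian vector in any orthonormal basis are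
  independent standard normal variables, and \<open>S(X)\<close> has the \<open>\<chi>\<^sup>2\<close> distribution with \<open>rank A\<close>
  degrees of freedom (lemma \<open>distr_sum_squares_std_normal\<close>). The theorem follows by comparing
  events: \<open>X \<bullet> A X > s\<close> forces \<open>S(X) > s / \<lambda>\<close> when \<open>\<lambda> > 0\<close> and \<open>S(X) < s / \<lambda>\<close> when
  \<open>\<lambda> < 0\<close>.
\<close>

section \<open>Gaussian vectors in orthonormal coordinates\<close>

lemma nn_integral_lborel_translate:
  fixes g :: "'a::euclidean_space \<Rightarrow> ennreal"
  assumes [measurable]: "g \<in> borel_measurable borel"
  shows "(\<integral>\<^sup>+x. g (c + x) \<partial>lborel) = (\<integral>\<^sup>+x. g x \<partial>lborel)"
proof -
  have "(\<integral>\<^sup>+x. g x \<partial>lborel) = (\<integral>\<^sup>+x. g x \<partial>distr lborel borel ((+) c))"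
    by (simp only: lborel_distr_plus)
  also have "\<dots> = (\<integral>\<^sup>+x. g (c + x) \<partial>lborel)"
    by (rule nn_integral_distr) auto
  finally show ?thesis ..
qed

text \<open>
  The argument is the one that shows the uniqueness of Haar measure. The product of the measures of
  \<open>E\<close> and of the unit ball is rewritten, by Fubini and two translations, into the product of the
  measures of \<open>f -` E\<close> and of a unit ball; the ball enters because its centre, but not its shape,
  changes under \<open>f\<close>.
\<close>
lemma lborel_distr_orthogonal_transformation:
  fixes f :: "'a::euclidean_space \<Rightarrow> 'a"
  assumes f: "orthogonal_transformation f"
  shows "distr lborel borel f = lborel"
proof (rule measure_eqI)
  define g where "g = inv f"
  have lin: "linear f" and bij: "bij f" and g: "orthogonal_transformation g"
    using f orthogonal_transformation_inv orthogonal_transformation_linear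
      orthogonal_transformation_bij by (auto simp: g_def)
  have fg: "f (g x) = x" for x
    using bij by (simp add: g_def bij_is_surj surj_f_inv_f)
  have [measurable]: "f \<in> borel_measurable borel" "g \<in> borel_measurable borel"
    using lin orthogonal_transformation_linear[OF g]
    by (auto intro!: borel_measurable_continuous_onI linear_continuous_on
        simp: linear_conv_bounded_linear)
  fix E assume "E \<in> sets (distr lborel borel f)"
  then have [measurable]: "E \<in> sets borel" by simp
  define B where "B = ball (0::'a) 1"
  have [measurable]: "B \<in> sets borel" by (simp add: B_def)
  let ?i = "\<lambda>S x. indicator S x :: ennreal"
  have "emeasure lborel E * emeasure lborel B
      = (\<integral>\<^sup>+z. (\<integral>\<^sup>+x. ?i E x * ?i B z \<partial>lborel) \<partial>lborel)"
    by (simp add: nn_integral_multc nn_integral_cmult_indicator)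
  also have "\<dots> = (\<integral>\<^sup>+z. (\<integral>\<^sup>+x. ?i E (f z + x) * ?i B z \<partial>lborel) \<partial>lborel)"
    by (intro nn_integral_cong nn_integral_lborel_translate[symmetric]) measurable
  also have "\<dots> = (\<integral>\<^sup>+x. (\<integral>\<^sup>+z. ?i E (f z + x) * ?i B z \<partial>lborel) \<partial>lborel)"
    by (rule lborel_pair.Fubini') measurable
  also have "\<dots> = (\<integral>\<^sup>+x. (\<integral>\<^sup>+z. ?i E (f z) * ?i B (z - g x) \<partial>lborel) \<partial>lborel)"
  proof (rule nn_integral_cong)
    fix x
    have "(\<integral>\<^sup>+z. ?i E (f z) * ?i B (z - g x) \<partial>lborel)
        = (\<integral>\<^sup>+z. ?i E (f (g x + z)) * ?i B (g x + z - g x) \<partial>lborel)"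
      by (rule nn_integral_lborel_translate[symmetric]) measurable
    then show "(\<integral>\<^sup>+z. ?i E (f z + x) * ?i B z \<partial>lborel)
        = (\<integral>\<^sup>+z. ?i E (f z) * ?i B (z - g x) \<partial>lborel)"
      by (simp add: linear_add[OF lin] fg add.commute)
  qed
  also have "\<dots> = (\<integral>\<^sup>+x. (\<integral>\<^sup>+z. ?i E (f z) * ?i (ball (f z) 1) x \<partial>lborel) \<partial>lborel)"
  proof -
    have "norm (z - g x) = dist (f z) x" for x z
    proof -
      have "norm (z - g x) = norm (f (z - g x))"
        using f by (simp add: orthogonal_transformation)
      then show ?thesis by (simp add: linear_diff[OF lin] fg dist_norm)
    qed
    then show ?thesis by (simp add: indicator_def B_def)
  qed
  also have "\<dots> = (\<integral>\<^sup>+z. (\<integral>\<^sup>+x. ?i E (f z) * ?i (ball (f z) 1) x \<partial>lborel) \<partial>lborel)"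
  proof (rule lborel_pair.Fubini')
    have "(\<lambda>(z, x). ?i E (f z) * ?i B (x - f z)) \<in> borel_measurable (lborel \<Otimes>\<^sub>M lborel)"
      by measurable
    then show "(\<lambda>(z, x). ?i E (f z) * ?i (ball (f z) 1) x) \<in> borel_measurable (lborel \<Otimes>\<^sub>M lborel)"
      by (simp add: indicator_def B_def dist_norm norm_minus_commute)
  qed
  also have "\<dots> = (\<integral>\<^sup>+z. ?i (f -` E) z * emeasure lborel B \<partial>lborel)"
    by (simp add: nn_integral_cmult_indicator emeasure_ball indicator_vimage[symmetric] B_def)
  also have "\<dots> = emeasure lborel (f -` E) * emeasure lborel B"
    using measurable_sets_borel[of f borel E] by (simp add: nn_integral_multc)
  finally have "emeasure lborel E * emeasure lborel B = emeasure lborel (f -` E) * emeasure lborel B" .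
  moreover have "emeasure lborel B \<noteq> 0" "emeasure lborel B \<noteq> \<infinity>"
    using less_imp_neq[OF unit_ball_vol_pos[of "real DIM('a)"]]
    by (simp_all add: B_def emeasure_ball)
  ultimately have "emeasure lborel (f -` E) = emeasure lborel E"
    by (simp add: mult.commute[of _ "emeasure lborel B"] ennreal_mult_cancel_left)
  then show "emeasure (distr lborel borel f) E = emeasure lborel E"
    by (simp add: emeasure_distr)
qed simp

lemma orthonormal_extend_to_basis:
  fixes B :: "'a::euclidean_space set"
  assumes orth: "pairwise orthogonal B" and norm: "\<And>b. b \<in> B \<Longrightarrow> norm b = 1"
  obtains C where "B \<subseteq> C" "pairwise orthogonal C" "\<And>c. c \<in> C \<Longrightarrow> norm c = 1"
    "span C = UNIV" "finite C"
proof -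
  obtain U where U: "U \<inter> insert 0 B = {}" "pairwise orthogonal (B \<union> U)"
    "span (B \<union> U) = span (B \<union> UNIV)"
    using orthogonal_extension_strong[OF orth] by metis
  let ?n = "\<lambda>x::'a. inverse (norm x) *\<^sub>R x"
  let ?C = "?n ` (B \<union> U)"
  have "0 \<notin> B" using norm by force
  then have nz: "x \<noteq> 0" if "x \<in> B \<union> U" for x using U(1) that by auto
  have ind: "independent (B \<union> U)"
    using pairwise_orthogonal_independent[OF U(2)] nz by blast
  then have fin: "finite (B \<union> U)" by (rule independent_imp_finite)
  show ?thesis
  proof
    show "B \<subseteq> ?C"
    proof
      fix b assume "b \<in> B"
      then have "b = ?n b" "b \<in> B \<union> U" using norm by auto
      then show "b \<in> ?C" by (rule image_eqI)
    qed
    show "pairwise orthogonal ?C"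
    proof (rule pairwiseI)
      fix c d assume "c \<in> ?C" "d \<in> ?C" "c \<noteq> d"
      then obtain x y where "x \<in> B \<union> U" "y \<in> B \<union> U" "c = ?n x" "d = ?n y" "x \<noteq> y"
        by blast
      then show "orthogonal c d"
        using U(2) by (simp add: pairwise_def orthogonal_clauses)
    qed
    show "norm c = 1" if "c \<in> ?C" for c using that nz by auto
    show "span ?C = UNIV"
      using span_image_scale[OF fin, of "\<lambda>x. inverse (norm x)"] nz U(3) by simp
    show "finite ?C" using fin by simp
  qed
qed

lemma card_orthonormal_basis:
  fixes C :: "'a::euclidean_space set"
  assumes orth: "pairwise orthogonal C" and norm: "\<And>c. c \<in> C \<Longrightarrow> norm c = 1"
    and span: "span C = UNIV"
  shows "card C = DIM('a)"
proof -
  have "0 \<notin> C" using norm[of 0] by auto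
  then have "dim C = card C"
    using pairwise_orthogonal_independent[OF orth] by (intro dim_eq_card_independent)
  then show ?thesis using dim_span[of C] by (simp add: span)
qed

lemma mvnormal_density_std_eq_prod:
  fixes C :: "(real^'n) set"
  assumes orth: "pairwise orthogonal C" and norm: "\<And>c. c \<in> C \<Longrightarrow> norm c = 1"
    and span: "span C = UNIV" and fin: "finite C"
  shows "mvnormal_density 0 (mat 1) x = (\<Prod>c\<in>C. std_normal_density (x \<bullet> c))"
proof -
  have card: "card C = CARD('n)"
    using card_orthonormal_basis[OF orth norm span] by simp
  have inv1: "matrix_inv (mat 1 :: real^'n^'n) = mat 1"
    by (simp add: matrix_inv_def)
  have "x \<bullet> x = x \<bullet> (\<Sum>c\<in>C. (x \<bullet> c) *\<^sub>R c)"
    using orthonormal_basis_expand[OF orth norm _ fin, of x] span by simp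
  also have "\<dots> = (\<Sum>c\<in>C. (x \<bullet> c)\<^sup>2)"
    by (simp add: inner_sum_right power2_eq_square)
  finally have sq: "x \<bullet> x = (\<Sum>c\<in>C. (x \<bullet> c)\<^sup>2)" .
  have "(\<Prod>c\<in>C. std_normal_density (x \<bullet> c))
      = (1 / sqrt (2 * pi)) ^ card C * exp (\<Sum>c\<in>C. - (x \<bullet> c)\<^sup>2 / 2)"
    by (simp only: std_normal_density_def prod.distrib prod_constant exp_sum[OF fin])
  also have "(\<Sum>c\<in>C. - (x \<bullet> c)\<^sup>2 / 2) = - (x \<bullet> x) / 2"
    by (simp add: sq sum_negf sum_divide_distrib)
  finally show ?thesis
    unfolding mvnormal_density_def
    by (simp add: inv1 card power_divide power_mult_distrib real_sqrt_mult real_sqrt_power)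
qed

abbreviation std_normal_measure :: "real measure" where
  "std_normal_measure \<equiv> density lborel (\<lambda>x. ennreal (std_normal_density x))"

text \<open>
  Both sides are compared on boxes. The integral over a box is a product of functions of the single
  coordinates \<open>x \<bullet> c\<close>; the orthogonal map that sends the basis \<open>C\<close> to the standard one turns it into
  an integral in standard coordinates without changing Lebesgue measure, and there it factorises.
\<close>
lemma distr_std_normal_orthonormal_coordinates:
  fixes C :: "(real^'n) set"
  assumes orth: "pairwise orthogonal C" and norm: "\<And>c. c \<in> C \<Longrightarrow> norm c = 1"
    and span: "span C = UNIV" and fin: "finite C"
  shows "distr (density lborel (\<lambda>x. ennreal (mvnormal_density 0 (mat 1) x)))
      (\<Pi>\<^sub>M c\<in>C. std_normal_measure) (\<lambda>x. \<lambda>c\<in>C. x \<bullet> c) = (\<Pi>\<^sub>M c\<in>C. std_normal_measure)"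
    (is "distr ?G ?P ?co = ?P")
proof -
  interpret N: prob_space std_normal_measure
    by (rule prob_space_normal_density) simp
  interpret product_sigma_finite "\<lambda>_::real^'n. std_normal_measure"
    by (rule product_sigma_finite.intro) (rule N.sigma_finite_measure_axioms)
  have "card C = card (Basis :: (real^'n) set)"
    by (rule card_orthonormal_basis[OF orth norm span])
  then obtain h where h: "bij_betw h (Basis :: (real^'n) set) C"
    using finite_same_card_bij[of "Basis :: (real^'n) set" C] fin by auto
  define f where "f x = (\<Sum>b\<in>Basis. (x \<bullet> h b) *\<^sub>R b)" for x :: "real^'n"
  have fb: "f x \<bullet> b = x \<bullet> h b" if "b \<in> Basis" for x b
    using that by (simp add: f_def inner_sum_left_Basis)
  have "linear f"
    by (rule linearI) (simp_all add: f_def inner_add_left scaleR_add_left sum.distrib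
        scaleR_sum_right)
  moreover have "f v \<bullet> f w = v \<bullet> w" for v w
  proof -
    have "f v \<bullet> f w = (\<Sum>b\<in>Basis. (v \<bullet> h b) * (w \<bullet> h b))"
      by (subst euclidean_inner) (simp add: fb)
    also have "\<dots> = (\<Sum>c\<in>C. (v \<bullet> c) * (w \<bullet> c))"
      by (rule sum.reindex_bij_betw[OF h])
    also have "\<dots> = v \<bullet> (\<Sum>c\<in>C. (w \<bullet> c) *\<^sub>R c)"
      by (simp add: inner_sum_right mult.commute)
    also have "\<dots> = v \<bullet> w"
      using orthonormal_basis_expand[OF orth norm _ fin, of w] span by simp
    finally show ?thesis .
  qed
  ultimately have f: "orthogonal_transformation f"
    by (simp add: orthogonal_transformation_def)
  have [measurable]: "f \<in> borel_measurable borel"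
    using \<open>linear f\<close> by (intro borel_measurable_continuous_onI linear_continuous_on)
      (simp add: linear_conv_bounded_linear)
  have dens: "(\<lambda>x::real^'n. ennreal (mvnormal_density 0 (mat 1) x))
      = (\<lambda>x. \<Prod>c\<in>C. ennreal (std_normal_density (x \<bullet> c)))"
    by (simp add: mvnormal_density_std_eq_prod[OF orth norm span fin] prod_ennreal)
  have [measurable]: "?co \<in> measurable borel ?P"
    by (intro measurable_restrict) simp
  show ?thesis
  proof (rule PiM_eqI)
    fix F :: "real^'n \<Rightarrow> real set"
    assume "\<And>c. c \<in> C \<Longrightarrow> F c \<in> sets std_normal_measure"
    then have F [measurable]: "F c \<in> sets borel" if "c \<in> C" for c using that by simp
    have PF [measurable]: "Pi\<^sub>E C F \<in> sets ?P"
      using F fin by (intro sets_PiM_I_finite) auto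
    let ?g = "\<lambda>c y. ennreal (std_normal_density y) * indicator (F c) y"
    have hC: "h b \<in> C" if "b \<in> Basis" for b
      using h that by (auto simp: bij_betw_def)
    have ind: "indicator (?co -` Pi\<^sub>E C F) x = (\<Prod>c\<in>C. indicator (F c) (x \<bullet> c) :: ennreal)" for x
      using fin by (auto simp: indicator_def PiE_iff prod_zero_iff split: if_splits)
    have "emeasure (distr ?G ?P ?co) (Pi\<^sub>E C F) = emeasure ?G (?co -` Pi\<^sub>E C F)"
      by (subst emeasure_distr) (auto simp: PF)
    also have "\<dots> = (\<integral>\<^sup>+x. (\<Prod>c\<in>C. ennreal (std_normal_density (x \<bullet> c)))
        * indicator (?co -` Pi\<^sub>E C F) x \<partial>lborel)"
      unfolding dens using measurable_sets_borel[OF \<open>?co \<in> measurable borel ?P\<close> PF]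
      by (subst emeasure_density) auto
    also have "\<dots> = (\<integral>\<^sup>+x. (\<Prod>c\<in>C. ?g c (x \<bullet> c)) \<partial>lborel)"
      by (simp add: ind prod.distrib)
    also have "\<dots> = (\<integral>\<^sup>+x. (\<Prod>b\<in>Basis. ?g (h b) (x \<bullet> h b)) \<partial>lborel)"
      by (intro nn_integral_cong prod.reindex_bij_betw[OF h, symmetric])
    also have "\<dots> = (\<integral>\<^sup>+x. (\<Prod>b\<in>Basis. ?g (h b) (f x \<bullet> b)) \<partial>lborel)"
      by (intro nn_integral_cong prod.cong) (simp_all add: fb)
    also have "\<dots> = (\<integral>\<^sup>+x. (\<Prod>b\<in>Basis. ?g (h b) (x \<bullet> b)) \<partial>distr lborel borel f)"
      by (subst nn_integral_distr) (auto simp: hC)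
    also have "\<dots> = (\<integral>\<^sup>+x. (\<Prod>b\<in>Basis. ?g (h b) (x \<bullet> b)) \<partial>lborel)"
      by (simp only: lborel_distr_orthogonal_transformation[OF f])
    also have "\<dots> = (\<Prod>b\<in>Basis. \<integral>\<^sup>+y. ?g (h b) y \<partial>lborel)"
      by (rule nn_integral_lborel_prod) (auto simp: hC)
    also have "\<dots> = (\<Prod>c\<in>C. \<integral>\<^sup>+y. ?g c y \<partial>lborel)"
      by (rule prod.reindex_bij_betw[OF h])
    also have "\<dots> = (\<Prod>c\<in>C. emeasure std_normal_measure (F c))"
      by (intro prod.cong refl) (simp add: emeasure_density F)
    finally show "emeasure (distr ?G ?P ?co) (Pi\<^sub>E C F)
      = (\<Prod>c\<in>C. emeasure std_normal_measure (F c))" .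
  qed (use fin in auto)
qed

lemma distr_sum_squares_std_normal:
  fixes B :: "(real^'n) set"
  assumes orth: "pairwise orthogonal B" and norm: "\<And>b. b \<in> B \<Longrightarrow> norm b = 1"
  shows "distr (density lborel (\<lambda>x. ennreal (mvnormal_density 0 (mat 1) x))) borel
      (\<lambda>x. \<Sum>b\<in>B. (x \<bullet> b)\<^sup>2) = chi_square (card B)"
    (is "distr ?G borel ?S = _")
proof -
  obtain C where C: "B \<subseteq> C" "pairwise orthogonal C" "\<And>c. c \<in> C \<Longrightarrow> norm c = 1"
    "span C = UNIV" "finite C"
    using orthonormal_extend_to_basis[OF orth norm] by metis
  have "finite B" using C finite_subset by blast
  then obtain g where g: "bij_betw g {..<card B} B"
    using ex_bij_betw_nat_finite[of B] by (auto simp: atLeast0LessThan)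
  let ?PC = "\<Pi>\<^sub>M c\<in>C. std_normal_measure"
  let ?PI = "\<Pi>\<^sub>M i\<in>{..<card B}. std_normal_measure"
  let ?co = "\<lambda>x::real^'n. \<lambda>c\<in>C. x \<bullet> c"
  let ?re = "\<lambda>w. \<lambda>i\<in>{..<card B}. w (g i)"
  let ?q = "\<lambda>z. \<Sum>i<card B. (z i :: real)\<^sup>2"
  have gC: "g i \<in> C" if "i < card B" for i
    using g C(1) that by (auto simp: bij_betw_def)
  have [measurable]: "?co \<in> measurable ?G ?PC"
    by (intro measurable_restrict) simp
  have [measurable]: "?re \<in> measurable ?PC ?PI"
    by (intro measurable_restrict) (use gC in auto)
  have [measurable]: "?q \<in> borel_measurable ?PI"
    by measurable
  have "distr ?PC ?PI ?re = ?PI"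
    by (rule distr_PiM_reindex)
      (use g gC prob_space_normal_density in \<open>auto simp: bij_betw_def\<close>)
  then have "chi_square (card B) = distr (distr (distr ?G ?PC ?co) ?PI ?re) borel ?q"
    by (simp add: chi_square_def distr_std_normal_orthonormal_coordinates[OF C(2-5)])
  also have "\<dots> = distr ?G borel (?q \<circ> (?re \<circ> ?co))"
    by (simp add: distr_distr)
  also have "?q \<circ> (?re \<circ> ?co) = ?S"
  proof
    fix x
    have "(?q \<circ> (?re \<circ> ?co)) x = (\<Sum>i<card B. (x \<bullet> g i)\<^sup>2)"
      by (simp add: gC)
    also have "\<dots> = ?S x" by (rule sum.reindex_bij_betw[OF g])
    finally show "(?q \<circ> (?re \<circ> ?co)) x = ?S x" .
  qed
  finally show ?thesis ..
qed

section \<open>The quadratic form of a symmetric matrix\<close>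

lemma symmetric_matrix_inner:
  fixes A :: "real^'n^'n"
  assumes "transpose A = A"
  shows "x \<bullet> (A *v y) = (A *v x) \<bullet> y"
  by (metis assms dot_lmul_matrix transpose_matrix_vector)

lemma finite_eigenvalues_symmetric:
  fixes A :: "real^'n^'n"
  assumes sym: "transpose A = A"
  shows "finite {l. eigenvalue A l}"
proof -
  have "\<forall>l. \<exists>v. eigenvalue A l \<longrightarrow> v \<noteq> 0 \<and> A *v v = l *\<^sub>R v"
    by (auto simp: eigenvalue_def)
  from choice[OF this] obtain v
    where v: "\<And>l. eigenvalue A l \<Longrightarrow> v l \<noteq> 0 \<and> A *v v l = l *\<^sub>R v l"
    by blast
  have orth: "v l \<bullet> v m = 0" if "eigenvalue A l" "eigenvalue A m" "l \<noteq> m" for l m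
    using symmetric_matrix_inner[OF sym, of "v l" "v m"] v that by simp
  have "inj_on v {l. eigenvalue A l}"
    by (rule inj_onI) (metis inner_eq_zero_iff mem_Collect_eq orth v)
  moreover have "independent (v ` {l. eigenvalue A l})"
    by (rule pairwise_orthogonal_independent)
      (use orth v in \<open>fastforce simp: pairwise_def orthogonal_def\<close>)+
  ultimately show ?thesis
    using independent_imp_finite finite_image_iff by blast
qed

text \<open>
  The maximiser \<open>v\<close> of the form on the unit sphere of \<open>W\<close> is an eigenvector: if the residual
  \<open>A v - \<mu> v\<close> were nonzero, moving \<open>v\<close> slightly in its direction, which stays within the
  invariant space \<open>W\<close>, would increase the Rayleigh quotient beyond its maximum \<open>\<mu>\<close>.
\<close>
lemma Rayleigh_maximum_eigenvector:
  fixes A :: "real^'n^'n"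
  assumes sym: "transpose A = A" and W: "subspace W" and inv: "\<And>y. y \<in> W \<Longrightarrow> A *v y \<in> W"
    and nontriv: "w \<in> W" "w \<noteq> 0"
  obtains v \<mu> where "v \<in> W" "v \<noteq> 0" "A *v v = \<mu> *\<^sub>R v"
    "\<And>y. y \<in> W \<Longrightarrow> y \<bullet> (A *v y) \<le> \<mu> * (y \<bullet> y)"
proof -
  let ?K = "sphere 0 1 \<inter> W"
  have "inverse (norm w) *\<^sub>R w \<in> ?K"
    using nontriv W by (simp add: subspace_scale)
  then have "?K \<noteq> {}" by blast
  moreover have "compact ?K"
    using W by (intro compact_Int_closed closed_subspace) auto
  moreover have "continuous_on ?K (\<lambda>y. y \<bullet> (A *v y))"
    by (intro continuous_intros matrix_vector_mult_linear_continuous_on)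
  ultimately have "\<exists>v\<in>?K. \<forall>y\<in>?K. y \<bullet> (A *v y) \<le> v \<bullet> (A *v v)"
    by (intro continuous_attains_sup)
  then obtain v where v: "v \<in> ?K" and max: "\<And>y. y \<in> ?K \<Longrightarrow> y \<bullet> (A *v y) \<le> v \<bullet> (A *v v)"
    by blast
  define \<mu> where "\<mu> = v \<bullet> (A *v v)"
  have vW: "v \<in> W" and vv: "v \<bullet> v = 1" using v by (auto simp: norm_eq_1)
  have le: "y \<bullet> (A *v y) \<le> \<mu> * (y \<bullet> y)" if "y \<in> W" for y
  proof (cases "y = 0")
    case False
    let ?z = "inverse (norm y) *\<^sub>R y"
    have "?z \<in> ?K" using that W False by (simp add: subspace_scale)
    from max[OF this] have "inverse (norm y) * (inverse (norm y) * (y \<bullet> (A *v y))) \<le> \<mu>"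
      by (simp add: \<mu>_def matrix_vector_mult_scaleR)
    then show ?thesis
      using False by (simp add: field_simps power2_eq_square flip: power2_norm_eq_inner)
  qed simp
  define q where "q y = \<mu> * (y \<bullet> y) - y \<bullet> (A *v y)" for y
  define u where "u = A *v v - \<mu> *\<^sub>R v"
  have uW: "u \<in> W" unfolding u_def using vW W inv by (simp add: subspace_diff subspace_scale)
  have uAv: "u \<bullet> (A *v v) = u \<bullet> u + \<mu> * (u \<bullet> v)"
    by (simp add: u_def inner_diff_right inner_diff_left algebra_simps)
  have vAu: "v \<bullet> (A *v u) = u \<bullet> (A *v v)"
    using symmetric_matrix_inner[OF sym] by (simp add: inner_commute)
  have q_move: "q (v + c *\<^sub>R u) = c * (c * q u - 2 * (u \<bullet> u))" for c
    unfolding q_def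
    by (simp add: matrix_vector_right_distrib matrix_vector_mult_scaleR inner_add_left
        inner_add_right vAu uAv vv \<mu>_def[symmetric] inner_commute[of v u] algebra_simps)
  have "u = 0"
  proof (rule ccontr)
    assume "u \<noteq> 0"
    then have pos: "u \<bullet> u > 0" by simp
    have qu: "q u \<ge> 0" using le[OF uW] by (simp add: q_def)
    \<comment> \<open>a step so small that the quadratic term of \<open>q_move\<close> cannot outweigh the linear one\<close>
    let ?c = "(u \<bullet> u) / (q u + 1)"
    have c: "?c > 0" using pos qu by simp
    have "v + ?c *\<^sub>R u \<in> W" using vW uW W by (simp add: subspace_add subspace_scale)
    then have "q (v + ?c *\<^sub>R u) \<ge> 0" using le by (simp add: q_def)
    then have "?c * q u - 2 * (u \<bullet> u) \<ge> 0"
      using c by (simp only: q_move zero_le_mult_iff) linarith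
    moreover have "?c * q u \<le> u \<bullet> u"
      using pos qu by (simp add: field_simps)
    ultimately show False using pos by linarith
  qed
  then show ?thesis
    using that[OF vW, of \<mu>] vv le by (force simp: u_def)
qed

text \<open>
  The vector \<open>y\<close> of the proof is the projection of \<open>x\<close> to the range of \<open>A\<close>. The difference \<open>x - y\<close> is
  orthogonal to the range, hence in the kernel, so \<open>x\<close> may be replaced by \<open>y\<close>, where the Rayleigh
  bound applies. If \<open>\<lambda>\<close> is negative this still gives the right direction, because the maximum is taken
  over the range alone and \<open>y \<bullet> y\<close> is nonnegative.
\<close>
lemma quadratic_form_le_projection:
  fixes A :: "real^'n^'n"
  assumes sym: "transpose A = A" and nz: "A \<noteq> 0"
    and orth: "pairwise orthogonal B" and norm: "\<And>b. b \<in> B \<Longrightarrow> norm b = 1"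
    and span: "span B = range (\<lambda>x. A *v x)" and fin: "finite B"
  shows "x \<bullet> (A *v x) \<le> largest_nonzero_eigenvalue A * (\<Sum>b\<in>B. (x \<bullet> b)\<^sup>2)"
proof -
  let ?W = "range (\<lambda>x. A *v x)"
  have W: "subspace ?W" using span subspace_span by metis
  have ker: "z = 0" if "z \<in> ?W" "A *v z = 0" for z
  proof -
    from that(1) obtain w where "z = A *v w" by auto
    then have "z \<bullet> z = 0" using symmetric_matrix_inner[OF sym, of z w] that by simp
    then show ?thesis by simp
  qed
  obtain w where w: "A *v w \<noteq> 0"
    using nz by (metis matrix_eq matrix_vector_mult_0)
  obtain v \<mu> where v: "v \<in> ?W" "v \<noteq> 0" "A *v v = \<mu> *\<^sub>R v"
    and le: "\<And>y. y \<in> ?W \<Longrightarrow> y \<bullet> (A *v y) \<le> \<mu> * (y \<bullet> y)"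
    using Rayleigh_maximum_eigenvector[OF sym W rangeI rangeI w] by blast
  have "\<mu> \<noteq> 0" using ker[OF v(1)] v(2,3) by auto
  then have "\<mu> \<in> {l. eigenvalue A l \<and> l \<noteq> 0}"
    using v by (auto simp: eigenvalue_def)
  moreover have "finite {l. eigenvalue A l \<and> l \<noteq> 0}"
    using finite_eigenvalues_symmetric[OF sym] by simp
  ultimately have mu: "\<mu> \<le> largest_nonzero_eigenvalue A"
    unfolding largest_nonzero_eigenvalue_def by (rule Max_ge[rotated])
  define y where "y = (\<Sum>b\<in>B. (x \<bullet> b) *\<^sub>R b)"
  have yW: "y \<in> ?W"
    unfolding y_def span[symmetric] by (intro span_sum span_scale span_base)
  have yb: "y \<bullet> b = x \<bullet> b" if "b \<in> B" for b
  proof -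
    have "c \<bullet> b = (if c = b then 1 else 0)" if "c \<in> B" for c
      using that \<open>b \<in> B\<close> orth norm by (auto simp: pairwise_def orthogonal_def norm_eq_1)
    then have "y \<bullet> b = (\<Sum>c\<in>B. if c = b then x \<bullet> c else 0)"
      unfolding y_def inner_sum_left by (intro sum.cong) auto
    then show ?thesis using that fin by simp
  qed
  have perp: "(x - y) \<bullet> z = 0" if "z \<in> ?W" for z
  proof -
    have "z \<in> span B" using that span by simp
    then show ?thesis
      by (induction rule: span_induct_alt)
        (simp_all add: inner_add_right inner_diff_left yb)
  qed
  have "(A *v (x - y)) \<bullet> (A *v (x - y)) = 0"
    using symmetric_matrix_inner[OF sym, of "x - y" "A *v (x - y)"] perp by simp
  then have Axy: "A *v x = A *v y"
    by (simp add: matrix_vector_mult_diff_distrib)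
  have "x \<bullet> (A *v x) = y \<bullet> (A *v y)"
    using perp[of "A *v y"] Axy by (simp add: inner_diff_left)
  also have "\<dots> \<le> \<mu> * (y \<bullet> y)" by (rule le[OF yW])
  also have "\<dots> \<le> largest_nonzero_eigenvalue A * (y \<bullet> y)"
    using mu by (simp add: mult_right_mono)
  also have "y \<bullet> y = (\<Sum>b\<in>B. (x \<bullet> b)\<^sup>2)"
    by (subst (2) y_def) (simp add: inner_sum_right yb power2_eq_square)
  finally show ?thesis .
qed

section \<open>The tail bound\<close>

theorem mainTheorem10:
  fixes M :: "'w measure" and X :: "'w \<Rightarrow> real^'n" and A :: "real^'n^'n" and t :: real
  assumes "prob_space M"
    and "distributed M lborel X (\<lambda>x. ennreal (mvnormal_density 0 (mat 1) x))"
    and "transpose A = A"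
    and "A \<noteq> 0"
    and "t > 0"
  shows "(largest_nonzero_eigenvalue A > 0 \<longrightarrow>
            measure M {\<omega> \<in> space M. X \<omega> \<bullet> (A *v X \<omega>) - trace A > t}
              \<le> 1 - cdf (chi_square (rank A)) ((t + trace A) / largest_nonzero_eigenvalue A)) \<and>
         (largest_nonzero_eigenvalue A < 0 \<longrightarrow>
            measure M {\<omega> \<in> space M. X \<omega> \<bullet> (A *v X \<omega>) - trace A > t}
              \<le> cdf (chi_square (rank A)) ((t + trace A) / largest_nonzero_eigenvalue A))"
proof -
  interpret prob_space M by fact
  let ?G = "density lborel (\<lambda>x::real^'n. ennreal (mvnormal_density 0 (mat 1) x))"
  have X [measurable]: "X \<in> borel_measurable M" and dX: "distr M lborel X = ?G"
    using assms(2) by (auto simp: distributed_def)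
  have "subspace (range (\<lambda>x. A *v x))"
    by (intro linear_subspace_image) (auto simp: matrix_vector_mul_linear)
  then obtain B where B: "pairwise orthogonal B" "\<And>b. b \<in> B \<Longrightarrow> norm b = 1"
    "independent B" "card B = dim (range (\<lambda>x. A *v x))" "span B = range (\<lambda>x. A *v x)"
    by (rule orthonormal_basis_subspace) blast
  have fin: "finite B" by (rule independent_imp_finite[OF B(3)])
  let ?r = "rank A" and ?l = "largest_nonzero_eigenvalue A" and ?s = "t + trace A"
  define S where "S = (\<lambda>x::real^'n. \<Sum>b\<in>B. (x \<bullet> b)\<^sup>2)"
  have [measurable]: "S \<in> borel_measurable borel" unfolding S_def by measurable
  have "chi_square ?r = distr ?G borel S"
    using distr_sum_squares_std_normal[OF B(1,2)] B(4) by (simp add: S_def rank_dim_range)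
  also have "\<dots> = distr M borel (\<lambda>\<omega>. S (X \<omega>))"
    unfolding dX[symmetric] by (subst distr_distr) (auto simp: comp_def)
  finally have chi: "chi_square ?r = distr M borel (\<lambda>\<omega>. S (X \<omega>))" .
  have F: "cdf (chi_square ?r) a = prob {\<omega> \<in> space M. S (X \<omega>) \<le> a}" for a
    unfolding chi cdf_def
    by (subst measure_distr) (auto intro!: arg_cong[where f = prob])
  have bound: "X \<omega> \<bullet> (A *v X \<omega>) \<le> ?l * S (X \<omega>)" for \<omega>
    unfolding S_def by (rule quadratic_form_le_projection) (use assms B fin in auto)
  let ?E = "{\<omega> \<in> space M. X \<omega> \<bullet> (A *v X \<omega>) - trace A > t}"
  have s: "?s < ?l * S (X \<omega>)" if "\<omega> \<in> ?E" for \<omega>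
    using bound[of \<omega>] that by simp
  show ?thesis
  proof (intro conjI impI)
    assume l: "?l > 0"
    have "prob ?E \<le> prob (space M - {\<omega> \<in> space M. S (X \<omega>) \<le> ?s / ?l})"
    proof (rule finite_measure_mono)
      show "?E \<subseteq> space M - {\<omega> \<in> space M. S (X \<omega>) \<le> ?s / ?l}"
        using s l by (force simp: field_simps)
    qed measurable
    also have "\<dots> = 1 - cdf (chi_square ?r) (?s / ?l)"
      unfolding F by (rule prob_compl) measurable
    finally show "prob ?E \<le> 1 - cdf (chi_square ?r) (?s / ?l)" .
  next
    assume l: "?l < 0"
    show "prob ?E \<le> cdf (chi_square ?r) (?s / ?l)"
      unfolding F
    proof (rule finite_measure_mono)
      show "?E \<subseteq> {\<omega> \<in> space M. S (X \<omega>) \<le> ?s / ?l}"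
        using s l by (force simp: field_simps)
    qed measurable
  qed
qed

end
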